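(* Let $\rho$ be a certainty equivalent, $L:\mathcal{D}\to\mathbb{R}$ an increasing loss function and $C\in\mathbb{R}$ with $C>L(0)$, and consider the notion of validity given, for every family of tests $\phi$ and every data-dependent level $\widetilde{\alpha}$, by $$\phi \text{ is valid for } \widetilde{\alpha} \iff \rho\big(\mathbb{E}^P[L(\phi(\widetilde{\alpha}))\mid\widetilde{\alpha}]\big)\le C .$$ Then this notion of validity nests classical validity if and only if $$\overline{L}(d_\alpha):=\frac{L(d_\alpha)-L(0)}{C-L(0)}=\frac{1}{\alpha}\qquad\text{for every }\alpha\in(0,1).$$
   Context: Setting. $\mathcal{X}$ is the sample space, equipped with a probability distribution $P$ (the simple null hypothesis). External randomization is available throughout: the probability space may be enriched, whenever needed, with a random variable $U\sim\mathrm{Unif}[0,1]$ independent of any other random variables being considered; equivalently, treat the underlying probability space as rich enough that for every finite family of random variables there is on it a $\mathrm{Unif}[0,1]$ random variable independent of that family. Random variables are identified when $P$-almost surely equal (in particular as arguments of $\rho$), and all maps whose probabilities or expectations are considered are assumed measurable. Conditional expectations of random variables bounded from below are taken in the generalized sense, with values in $(-\infty,\infty]$. Evidence space. $\mathcal{D}$ is a totally ordered set with least element $0$, containing for each $\alpha\in(0,1)$ an element $d_\alpha$ (the decision to reject at level $\alpha$), such that $d_{\alpha^+}\le d_{\alpha^-}$ whenever $\alpha^-\le\alpha^+$. The element $0$ represents a non-rejection. Tests. A family of tests $\phi$ is a collection of random variables $\phi(\alpha):\mathcal{X}\to\{0,d_\alpha\}$, $\alpha\in(0,1)$. A data-dependent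 level is a random variable $\widetilde{\alpha}:\mathcal{X}\to(0,1)$, and $\phi(\widetilde{\alpha})$ denotes the $\mathcal{D}$-valued map $x\mapsto\phi(\widetilde{\alpha}(x))(x)$. Classical validity: $\phi$ is valid at the (fixed) level $\alpha$ if $P(\phi(\alpha)=d_\alpha)\le\alpha$. Certainty equivalents. A certainty equivalent is a map $\rho$ from $[L(0),\infty]$-valued random variables to $[L(0),\infty]$ such that $X\equiv c$ implies $\rho(X)=c$. Nesting classical validity. A notion of validity nests classical validity if for every $\alpha\in(0,1)$ and every family of tests $\phi$: $\phi$ is valid for the constant level $\widetilde{\alpha}\equiv\alpha$ if and only if $P(\phi(\alpha)=d_\alpha)\le\alpha$. *)

theory Defs
  imports "HOL-Probability.Probability"
begin

(* Families of real-valued variables: if maps into arbitrary measurable spaces were admitted (such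
   as the identity of M), no uniform variable on the same space could be independent of them.
   Independence is that of the sigma-algebra of U from the one of the whole tuple X. *)
definition admits_randomization :: "'x measure \<Rightarrow> bool" where
  "admits_randomization M \<longleftrightarrow>
     (\<forall>(n::nat) (X :: nat \<Rightarrow> 'x \<Rightarrow> real).
        (\<forall>i<n. X i \<in> borel_measurable M) \<longrightarrow>
        (\<exists>U :: 'x \<Rightarrow> real.
           U \<in> borel_measurable M \<and>
           distr M borel U = uniform_measure lborel {0..1} \<and>
           prob_space.indep_set M
             (sets (vimage_algebra (space M) U borel))
             (sets (vimage_algebra (space M) (\<lambda>x. \<lambda>i\<in>{..<n}. X i x)
                      (Pi\<^sub>M {..<n} (\<lambda>_. borel))))))"

(* The non-rejection decision 0 is bot; d alpha is only meaningful for alpha in the open unit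
   interval, and likewise a family of tests phi is unconstrained outside it. Measurability into the
   count_space includes the requirement that phi alpha takes values in {bot, d alpha}. *)
definition test_family :: "'x measure \<Rightarrow> (real \<Rightarrow> 'd::bot) \<Rightarrow> (real \<Rightarrow> 'x \<Rightarrow> 'd) \<Rightarrow> bool" where
  "test_family M d \<phi> \<longleftrightarrow> (\<forall>\<alpha>\<in>{0<..<1}. \<phi> \<alpha> \<in> measurable M (count_space {bot, d \<alpha>}))"

definition data_dependent_level :: "'x measure \<Rightarrow> ('x \<Rightarrow> real) \<Rightarrow> bool" where
  "data_dependent_level M a \<longleftrightarrow>
     a \<in> borel_measurable M \<and> (\<forall>x\<in>space M. a x \<in> {0<..<1})"

definition nests_classical_validity ::
    "'x measure \<Rightarrow> (real \<Rightarrow> 'd::bot) \<Rightarrow> ((real \<Rightarrow> 'x \<Rightarrow> 'd) \<Rightarrow> ('x \<Rightarrow> real) \<Rightarrow> bool) \<Rightarrow> bool" where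
  "nests_classical_validity M d valid \<longleftrightarrow>
     (\<forall>\<alpha>\<in>{0<..<1}. \<forall>\<phi>. test_family M d \<phi> \<longrightarrow>
        (valid \<phi> (\<lambda>_. \<alpha>) \<longleftrightarrow> measure M {x \<in> space M. \<phi> \<alpha> x = d \<alpha>} \<le> \<alpha>))"

(* Generalized conditional expectation of X given F for X bounded below by b: shift X to be
   nonnegative, condition, shift back. Up to null sets the result does not depend on b; with this
   version it is everywhere in [b, \<infinity>]. *)
definition cond_exp_bounded_below ::
    "'x measure \<Rightarrow> 'x measure \<Rightarrow> real \<Rightarrow> ('x \<Rightarrow> real) \<Rightarrow> 'x \<Rightarrow> ereal" where
  "cond_exp_bounded_below M F b X x =
     ereal b + enn2ereal (nn_cond_exp M F (\<lambda>y. ennreal (X y - b)) x)"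

definition generated_algebra :: "'x measure \<Rightarrow> ('x \<Rightarrow> real) \<Rightarrow> 'x measure" where
  "generated_algebra M a = vimage_algebra (space M) a borel"

definition rv_above :: "'x measure \<Rightarrow> real \<Rightarrow> ('x \<Rightarrow> ereal) set" where
  "rv_above M b = {X \<in> borel_measurable M. \<forall>x\<in>space M. ereal b \<le> X x}"

(* The second conjunct says that rho depends on a random variable only up to almost sure equality;
   values of rho outside rv_above M b are irrelevant. *)
definition certainty_equivalent ::
    "'x measure \<Rightarrow> real \<Rightarrow> (('x \<Rightarrow> ereal) \<Rightarrow> ereal) \<Rightarrow> bool" where
  "certainty_equivalent M b \<rho> \<longleftrightarrow>
     (\<forall>X\<in>rv_above M b. ereal b \<le> \<rho> X) \<and>
     (\<forall>X\<in>rv_above M b. \<forall>Y\<in>rv_above M b. (AE x in M. X x = Y x) \<longrightarrow> \<rho> X = \<rho> Y) \<and>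
     (\<forall>c\<ge>ereal b. \<rho> (\<lambda>_. c) = c)"

end

theory Submission imports Defs begin

text \<open>
  For a constant level \<open>\<alpha>\<close> the conditional expectation is the constant
  \<open>L 0 + (L d\<^sub>\<alpha> - L 0) p\<close> with \<open>p = P(\<phi>(\<alpha>) = d\<^sub>\<alpha>)\<close>, so \<open>\<rho>\<close> plays no role and validity reads
  \<open>r p \<le> 1\<close>, where \<open>r\<close> is the normalized loss of \<open>d\<^sub>\<alpha>\<close>. Nesting excludes \<open>d\<^sub>\<alpha> = 0\<close>, as otherwise
  the zero test would be valid with \<open>p = 1\<close>. By randomization every \<open>p \<in> [0, 1]\<close> is then the
  rejection probability of some test, and \<open>r p \<le> 1 \<longleftrightarrow> p \<le> \<alpha>\<close> for all these \<open>p\<close> forces \<open>r = 1/\<alpha>\<close>.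
\<close>

text \<open>Three values of \<open>p\<close> suffice. \<open>p = 1\<close> gives
  \<open>r > 1\<close>, which makes \<open>1 / r\<close> an admissible value; then
  \<open>p = \<alpha>\<close> and \<open>p = 1 / r\<close>, the boundary points of the two
  conditions, give the two inequalities between \<open>r\<close> and
  \<open>1 / \<alpha>\<close>.\<close>

lemma mult_le_one_iff_le_all_imp_inverse:
  fixes r \<alpha> :: real
  assumes \<alpha>: "0 < \<alpha>" "\<alpha> < 1"
    and iff: "\<And>p. 0 \<le> p \<Longrightarrow> p \<le> 1 \<Longrightarrow> r * p \<le> 1 \<longleftrightarrow> p \<le> \<alpha>"
  shows "r = 1 / \<alpha>"
proof -
  have "r * 1 > 1"
    using iff[of 1] \<alpha> by auto
  then have r: "r > 1" by simp
  have "r * \<alpha> \<le> 1"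
    using iff[of \<alpha>] \<alpha> by auto
  moreover have "1 / r \<le> \<alpha>"
    using iff[of "1 / r"] r by simp
  ultimately show ?thesis
    using r \<alpha> by (simp add: field_simps)
qed

context prob_space
begin

text \<open>A constant map generates the trivial sigma-algebra: the preimage of \<open>B\<close> is
  empty or the whole space, according to whether \<open>a \<in> B\<close>. On these two sets
  \<open>f\<close> and its total integral integrate alike, since M has mass 1.\<close>

lemma nn_cond_exp_const_vimage:
  fixes a :: real and f :: "'a \<Rightarrow> ennreal"
  assumes f[measurable]: "f \<in> borel_measurable M"
  shows "AE x in M. nn_cond_exp M (generated_algebra M (\<lambda>_. a)) f x = (\<integral>\<^sup>+x. f x \<partial>M)"
proof -
  let ?F = "generated_algebra M (\<lambda>_. a)"
  have sub: "subalgebra M ?F"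
    unfolding generated_algebra_def subalgebra_def
    by (auto simp: sets_vimage_algebra2)
  interpret finite_measure_subalgebra M ?F
    by standard (rule sub)
  have "AE x in M. (\<integral>\<^sup>+x. f x \<partial>M) = nn_cond_exp M ?F f x"
  proof (rule nn_cond_exp_charact)
    fix A assume "A \<in> sets ?F"
    then obtain B where "A = (\<lambda>_. a) -` B \<inter> space M"
      unfolding generated_algebra_def by (auto simp: sets_vimage_algebra2)
    then consider "A = {}" | "A = space M"
      by (cases "a \<in> B") auto
    then show "(\<integral>\<^sup>+x\<in>A. f x \<partial>M) = (\<integral>\<^sup>+x\<in>A. (\<integral>\<^sup>+x. f x \<partial>M) \<partial>M)"
    proof cases
      case 2
      have "(\<integral>\<^sup>+x\<in>space M. g x \<partial>M) = (\<integral>\<^sup>+x. g x \<partial>M)" for g :: "'a \<Rightarrow> ennreal"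
        by (rule nn_integral_cong) (simp add: indicator_def)
      from this[of f] this[of "\<lambda>_. \<integral>\<^sup>+x. f x \<partial>M"] show ?thesis
        unfolding 2 by (simp add: emeasure_space_1)
    qed simp
  qed auto
  then show ?thesis
    by eventually_elim simp
qed

text \<open>The axioms on \<rho> speak only of members of \<open>rv_above M b\<close>. The lower
  bound holds at every point because \<open>nn_cond_exp\<close> has values in
  \<open>ennreal\<close>.\<close>

lemma cond_exp_bounded_below_in_rv_above:
  assumes "a \<in> borel_measurable M"
  shows "cond_exp_bounded_below M (generated_algebra M a) b X \<in> rv_above M b"
proof -
  let ?F = "generated_algebra M a"
  have sub: "subalgebra M ?F"
    using assms measurable_sets unfolding generated_algebra_def subalgebra_def
    by (auto simp: sets_vimage_algebra2)
  have [measurable]: "nn_cond_exp M ?F Y \<in> borel_measurable M" for Y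
    by (rule borel_measurable_nn_cond_exp2)
  have "ereal b \<le> ereal b + enn2ereal y" for y
    using add_left_mono[of 0 "enn2ereal y" "ereal b"] by simp
  then show ?thesis
    unfolding rv_above_def cond_exp_bounded_below_def by auto
qed

text \<open>A single uniform variable serves all levels: reject exactly when
  \<open>U x \<le> p\<close>. If \<open>d \<alpha> = bot\<close>, both decisions coincide and the
  event is the whole space, whence the condition.\<close>

lemma exists_test_family_with_prob:
  fixes d :: "real \<Rightarrow> 'd::order_bot"
  assumes "admits_randomization M" and p: "0 \<le> p" "p \<le> 1"
  obtains \<phi> where "test_family M d \<phi>"
    and "\<And>\<alpha>. d \<alpha> \<noteq> bot \<Longrightarrow> measure M {x \<in> space M. \<phi> \<alpha> x = d \<alpha>} = p"
proof -
  \<comment> \<open>Randomization is applied to the empty tuple, \<open>n = 0\<close>.\<close>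
  obtain U :: "'a \<Rightarrow> real" where U[measurable]: "U \<in> borel_measurable M"
    and dU: "distr M borel U = uniform_measure lborel {0..1}"
    using assms(1) unfolding admits_randomization_def
    by (metis less_zeroE)
  define \<phi> where "\<phi> = (\<lambda>\<alpha> x. if U x \<le> p then d \<alpha> else bot)"
  have tf: "test_family M d \<phi>"
    unfolding test_family_def \<phi>_def by (auto intro!: measurable_If)
  have "measure M {x \<in> space M. U x \<le> p} = measure (distr M borel U) {..p}"
    by (subst measure_distr) (auto intro!: arg_cong[where f = "measure M"])
  also have "\<dots> = measure lborel ({0..1} \<inter> {..p}) / measure lborel {0..1::real}"
    unfolding dU by (rule measure_uniform_measure) auto
  also have "{0..1} \<inter> {..p} = {0..p}" using p by auto
  finally have *: "measure M {x \<in> space M. U x \<le> p} = p" using p by simp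
  have "measure M {x \<in> space M. \<phi> \<alpha> x = d \<alpha>} = p" if "d \<alpha> \<noteq> bot" for \<alpha>
  proof -
    have "{x \<in> space M. \<phi> \<alpha> x = d \<alpha>} = {x \<in> space M. U x \<le> p}"
      using that by (auto simp: \<phi>_def)
    with * show ?thesis by simp
  qed
  with tf show ?thesis by (rule that)
qed

context
  fixes d :: "real \<Rightarrow> 'd::order_bot" and \<phi> :: "real \<Rightarrow> 'a \<Rightarrow> 'd" and L :: "'d \<Rightarrow> real"
    and \<alpha> :: real
  assumes tf: "test_family M d \<phi>" and \<alpha>: "\<alpha> \<in> {0<..<1}" and L: "mono L"
begin

lemma loss_test_measurable: "(\<lambda>x. L (\<phi> \<alpha> x)) \<in> borel_measurable M"
proof -
  have "\<phi> \<alpha> \<in> measurable M (count_space {bot, d \<alpha>})"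
    using tf \<alpha> unfolding test_family_def by blast
  then show ?thesis
    by (rule measurable_compose) simp
qed

lemma nn_integral_loss_test:
  "(\<integral>\<^sup>+x. ennreal (L (\<phi> \<alpha> x) - L bot) \<partial>M)
     = ennreal ((L (d \<alpha>) - L bot) * measure M {x \<in> space M. \<phi> \<alpha> x = d \<alpha>})"
proof -
  let ?A = "{x \<in> space M. \<phi> \<alpha> x = d \<alpha>}"
  have m: "\<phi> \<alpha> \<in> measurable M (count_space {bot, d \<alpha>})"
    using tf \<alpha> unfolding test_family_def by blast
  have "?A = \<phi> \<alpha> -` {d \<alpha>} \<inter> space M" by auto
  then have A: "?A \<in> sets M"
    using measurable_sets[OF m, of "{d \<alpha>}"] by simp
  have "(\<integral>\<^sup>+x. ennreal (L (\<phi> \<alpha> x) - L bot) \<partial>M)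
      = (\<integral>\<^sup>+x. ennreal (L (d \<alpha>) - L bot) * indicator ?A x \<partial>M)"
  proof (rule nn_integral_cong)
    fix x assume "x \<in> space M"
    moreover from this have "\<phi> \<alpha> x \<in> {bot, d \<alpha>}"
      using measurable_space[OF m] by simp
    \<comment> \<open>This also covers \<open>d \<alpha> = bot\<close>: the indicator is then 1, but
      its factor vanishes.\<close>
    ultimately show "ennreal (L (\<phi> \<alpha> x) - L bot)
        = ennreal (L (d \<alpha>) - L bot) * indicator ?A x"
      by (auto simp: indicator_def)
  qed
  also have "\<dots> = ennreal (L (d \<alpha>) - L bot) * emeasure M ?A"
    using A by (rule nn_integral_cmult_indicator)
  also have "\<dots> = ennreal ((L (d \<alpha>) - L bot) * measure M ?A)"
    \<comment> \<open>Monotonicity makes the loss difference nonnegative, so that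
      \<open>ennreal\<close> does not truncate it.\<close>
    using monoD[OF L, of bot "d \<alpha>"] by (simp add: emeasure_eq_measure ennreal_mult)
  finally show ?thesis .
qed

text \<open>The conditional expectation is almost surely constant. As \<rho> respects almost sure
  equality and fixes constants, its value is that constant.\<close>

lemma certainty_equivalent_const_level:
  assumes \<rho>: "certainty_equivalent M (L bot) \<rho>"
  shows "\<rho> (cond_exp_bounded_below M (generated_algebra M (\<lambda>_. \<alpha>)) (L bot) (\<lambda>x. L (\<phi> \<alpha> x)))
     = ereal (L bot + (L (d \<alpha>) - L bot) * measure M {x \<in> space M. \<phi> \<alpha> x = d \<alpha>})"
    (is "\<rho> ?E = ereal ?c")
proof -
  have Ld: "L bot \<le> L (d \<alpha>)"
    using L by (rule monoD) simp
  have c: "L bot \<le> ?c"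
    using Ld by simp
  have "(\<lambda>x. ennreal (L (\<phi> \<alpha> x) - L bot)) \<in> borel_measurable M"
    using loss_test_measurable by simp
  from nn_cond_exp_const_vimage[OF this, of \<alpha>] have eq: "AE x in M. ?E x = ereal ?c"
    unfolding nn_integral_loss_test
    by eventually_elim (use Ld in \<open>simp add: cond_exp_bounded_below_def enn2ereal_ennreal\<close>)
  have E: "?E \<in> rv_above M (L bot)"
    by (rule cond_exp_bounded_below_in_rv_above) simp
  have const: "(\<lambda>_. ereal ?c) \<in> rv_above M (L bot)"
    using c by (simp add: rv_above_def)
  from \<rho> have "\<forall>X\<in>rv_above M (L bot). \<forall>Y\<in>rv_above M (L bot).
      (AE x in M. X x = Y x) \<longrightarrow> \<rho> X = \<rho> Y"
    unfolding certainty_equivalent_def by (elim conjE)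
  from this[rule_format, OF E const eq] have "\<rho> ?E = \<rho> (\<lambda>_. ereal ?c)" .
  also from \<rho> have "\<forall>c\<ge>ereal (L bot). \<rho> (\<lambda>_. c) = c"
    unfolding certainty_equivalent_def by (elim conjE)
  then have "\<rho> (\<lambda>_. ereal ?c) = ereal ?c"
    using c by (simp only: ereal_less_eq)
  finally show ?thesis .
qed

end

end

theorem theorem4:
  fixes M :: "'x measure"
    and d :: "real \<Rightarrow> 'd::{linorder, order_bot}"
    and L :: "'d \<Rightarrow> real"
    and C :: real
    and \<rho> :: "('x \<Rightarrow> ereal) \<Rightarrow> ereal"
    and valid :: "(real \<Rightarrow> 'x \<Rightarrow> 'd) \<Rightarrow> ('x \<Rightarrow> real) \<Rightarrow> bool"
  assumes "prob_space M"
    and "admits_randomization M"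
    and "antimono_on {0<..<1} d"
    and "mono L"
    and "C > L bot"
    and "certainty_equivalent M (L bot) \<rho>"
    and "\<And>\<phi> a. \<lbrakk>test_family M d \<phi>; data_dependent_level M a;
                 (\<lambda>x. L (\<phi> (a x) x)) \<in> borel_measurable M\<rbrakk> \<Longrightarrow>
           valid \<phi> a \<longleftrightarrow>
             \<rho> (cond_exp_bounded_below M (generated_algebra M a) (L bot)
                  (\<lambda>x. L (\<phi> (a x) x))) \<le> ereal C"
  shows "nests_classical_validity M d valid \<longleftrightarrow>
           (\<forall>\<alpha>\<in>{0<..<1}. (L (d \<alpha>) - L bot) / (C - L bot) = 1 / \<alpha>)"
proof -
  interpret prob_space M by fact
  define r where "r = (\<lambda>\<alpha>. (L (d \<alpha>) - L bot) / (C - L bot))"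
  define p where "p = (\<lambda>\<phi> \<alpha>. measure M {x \<in> space M. \<phi> \<alpha> x = d \<alpha>})"
  have valid_iff: "valid \<phi> (\<lambda>_. \<alpha>) \<longleftrightarrow> r \<alpha> * p \<phi> \<alpha> \<le> 1"
    if tf: "test_family M d \<phi>" and \<alpha>: "\<alpha> \<in> {0<..<1}" for \<phi> \<alpha>
  proof -
    have "data_dependent_level M (\<lambda>_. \<alpha>)"
      using \<alpha> unfolding data_dependent_level_def by simp
    then have "valid \<phi> (\<lambda>_. \<alpha>) \<longleftrightarrow> L bot + (L (d \<alpha>) - L bot) * p \<phi> \<alpha> \<le> C"
      using assms(7)[OF tf, of "\<lambda>_. \<alpha>"] loss_test_measurable[OF tf \<alpha> \<open>mono L\<close>]
        certainty_equivalent_const_level[OF tf \<alpha> \<open>mono L\<close> assms(6)]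
      by (simp add: p_def)
    also have "\<dots> \<longleftrightarrow> r \<alpha> * p \<phi> \<alpha> \<le> 1"
      using \<open>C > L bot\<close> by (simp add: r_def field_simps)
    finally show ?thesis .
  qed
  \<comment> \<open>This eliminates \<rho> and \<open>valid\<close>: what remains compares two
    inequalities between real numbers.\<close>
  have nests: "nests_classical_validity M d valid \<longleftrightarrow>
      (\<forall>\<alpha>\<in>{0<..<1}. \<forall>\<phi>. test_family M d \<phi> \<longrightarrow> (r \<alpha> * p \<phi> \<alpha> \<le> 1 \<longleftrightarrow> p \<phi> \<alpha> \<le> \<alpha>))"
    unfolding nests_classical_validity_def using valid_iff by (simp add: p_def)
  have "nests_classical_validity M d valid \<longleftrightarrow> (\<forall>\<alpha>\<in>{0<..<1}. r \<alpha> = 1 / \<alpha>)"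
    unfolding nests
  proof (rule iffI; intro ballI allI impI)
    fix \<alpha> :: real
    assume nest: "\<forall>\<alpha>\<in>{0<..<1}. \<forall>\<phi>. test_family M d \<phi> \<longrightarrow> (r \<alpha> * p \<phi> \<alpha> \<le> 1 \<longleftrightarrow> p \<phi> \<alpha> \<le> \<alpha>)"
      and \<alpha>: "\<alpha> \<in> {0<..<1}"
    have d: "d \<alpha> \<noteq> bot"
    proof
      assume "d \<alpha> = bot"
      then have "r \<alpha> = 0" "p (\<lambda>_ _. bot) \<alpha> = 1"
        by (simp_all add: r_def p_def prob_space)
      moreover have "test_family M d (\<lambda>_ _. bot)"
        by (simp add: test_family_def)
      ultimately show False
        using nest \<alpha> by fastforce
    qed
    show "r \<alpha> = 1 / \<alpha>"
    proof (rule mult_le_one_iff_le_all_imp_inverse)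
      \<comment> \<open>Since \<open>d \<alpha> \<noteq> bot\<close>, every \<open>q\<close> is the
        rejection probability of a randomized test, to which nesting applies.\<close>
      fix q :: real assume "0 \<le> q" "q \<le> 1"
      with \<open>admits_randomization M\<close> obtain \<phi> where "test_family M d \<phi>" "p \<phi> \<alpha> = q"
        unfolding p_def using exists_test_family_with_prob[of q d] d by metis
      then show "r \<alpha> * q \<le> 1 \<longleftrightarrow> q \<le> \<alpha>"
        using nest \<alpha> by blast
    qed (use \<alpha> in auto)
  next
    fix \<alpha> :: real and \<phi>
    assume "\<forall>\<alpha>\<in>{0<..<1}. r \<alpha> = 1 / \<alpha>" "\<alpha> \<in> {0<..<1}"
    \<comment> \<open>Conversely, the two inequalities differ only by the positive factor
      \<alpha>.\<close>
    then show "r \<alpha> * p \<phi> \<alpha> \<le> 1 \<longleftrightarrow> p \<phi> \<alpha> \<le> \<alpha>"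
      by (simp add: divide_le_eq_1)
  qed
  then show ?thesis
    by (simp only: r_def)
qed

end
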